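(* Let $X$ be a finite set with $|X|\geq 2$ and let $\mathrm{FIM}_X$ be the free inverse monoid on $X$. Then $\mathrm{ConjGeo}(\mathrm{FIM}_X)$ is not a co-context-free language; that is, its complement $\tilde X^*\setminus \mathrm{ConjGeo}(\mathrm{FIM}_X)$ is not context-free, where $\tilde X=X\cup X^{-1}$.
   Context: $\tilde X = X\cup X^{-1}$, where $X^{-1}=\{x^{-1}: x\in X\}$ is a disjoint copy of $X$ consisting of formal inverses; $\tilde X^*$ is the free monoid on $\tilde X$, $\ell(w)$ is the length of a word $w\in\tilde X^*$, and $\pi\colon \tilde X^*\to \mathrm{FIM}_X$ is the canonical surjective homomorphism. A word $w\in\tilde X^*$ is a geodesic if $\ell(w)\le \ell(u)$ for every $u\in \tilde X^*$ with $u\pi=w\pi$; $\mathrm{Geo}(\mathrm{FIM}_X)$ is the set of all geodesics. Two elements $a,b$ of an inverse monoid $S$ are conjugate ($i$-conjugate) if there is $g\in S$ with $g^{-1}ag=b$ and $gbg^{-1}=a$. This is an equivalence relation; $[a]$ denotes the conjugacy class of $a$. $\mathrm{ConjGeo}(\mathrm{FIM}_X)=\{w\in \mathrm{Geo}(\mathrm{FIM}_X): \ell(w)\leq \ell(u)\text{ for all } u\in\tilde X^* \text{ such that } [w\pi]=[u\pi]\}$. *)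

theory Defs
  imports "HOL-Algebra.Group"
begin

section \<open>Inverse monoids and conjugacy\<close>

definition is_inverse :: "('a, 'b) monoid_scheme \<Rightarrow> 'a \<Rightarrow> 'a \<Rightarrow> bool" where
  "is_inverse S a b \<longleftrightarrow> b \<in> carrier S \<and>
     a \<otimes>\<^bsub>S\<^esub> b \<otimes>\<^bsub>S\<^esub> a = a \<and> b \<otimes>\<^bsub>S\<^esub> a \<otimes>\<^bsub>S\<^esub> b = b"

definition inverse_monoid :: "('a, 'b) monoid_scheme \<Rightarrow> bool" where
  "inverse_monoid S \<longleftrightarrow> monoid S \<and> (\<forall>a \<in> carrier S. \<exists>!b. is_inverse S a b)"

text \<open>The inverse in the sense of inverse semigroups; HOL-Algebra's \<open>m_inv\<close> is the
  group-theoretic inverse of a unit and is not appropriate here.\<close>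

definition sinv :: "('a, 'b) monoid_scheme \<Rightarrow> 'a \<Rightarrow> 'a" where
  "sinv S a = (THE b. is_inverse S a b)"

definition i_conj :: "('a, 'b) monoid_scheme \<Rightarrow> 'a \<Rightarrow> 'a \<Rightarrow> bool" where
  "i_conj S a b \<longleftrightarrow> (\<exists>g \<in> carrier S.
     sinv S g \<otimes>\<^bsub>S\<^esub> a \<otimes>\<^bsub>S\<^esub> g = b \<and> g \<otimes>\<^bsub>S\<^esub> b \<otimes>\<^bsub>S\<^esub> sinv S g = a)"

definition conj_class :: "('a, 'b) monoid_scheme \<Rightarrow> 'a \<Rightarrow> 'a set" where
  "conj_class S a = {b \<in> carrier S. i_conj S a b}"


section \<open>The free inverse monoid\<close>

datatype 'a letter = Pos 'a | Neg 'a

definition tilde :: "'a set \<Rightarrow> 'a letter set" where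
  "tilde X = Pos ` X \<union> Neg ` X"

fun letter_inv :: "'a letter \<Rightarrow> 'a letter" where
  "letter_inv (Pos x) = Neg x"
| "letter_inv (Neg x) = Pos x"

definition word_inv :: "'a letter list \<Rightarrow> 'a letter list" where
  "word_inv w = rev (map letter_inv w)"

text \<open>The Vagner congruence: the least congruence on the free monoid over \<open>tilde X\<close> that
  identifies \<open>u u\<inverse> u\<close> with \<open>u\<close> and \<open>u u\<inverse> v v\<inverse>\<close> with \<open>v v\<inverse> u u\<inverse>\<close>.\<close>

inductive vagner :: "'a set \<Rightarrow> 'a letter list \<Rightarrow> 'a letter list \<Rightarrow> bool" for X where
  regular: "u \<in> lists (tilde X) \<Longrightarrow> vagner X (u @ word_inv u @ u) u"
| commute: "u \<in> lists (tilde X) \<Longrightarrow> v \<in> lists (tilde X) \<Longrightarrow>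
    vagner X (u @ word_inv u @ v @ word_inv v) (v @ word_inv v @ u @ word_inv u)"
| refl: "u \<in> lists (tilde X) \<Longrightarrow> vagner X u u"
| sym: "vagner X u v \<Longrightarrow> vagner X v u"
| trans: "vagner X u v \<Longrightarrow> vagner X v w \<Longrightarrow> vagner X u w"
| cong: "vagner X u v \<Longrightarrow> p \<in> lists (tilde X) \<Longrightarrow> q \<in> lists (tilde X) \<Longrightarrow>
    vagner X (p @ u @ q) (p @ v @ q)"

definition vagner_rel :: "'a set \<Rightarrow> ('a letter list \<times> 'a letter list) set" where
  "vagner_rel X = {(u, v). vagner X u v}"

definition fim_proj :: "'a set \<Rightarrow> 'a letter list \<Rightarrow> 'a letter list set" where
  "fim_proj X w = vagner_rel X `` {w}"

definition FIM :: "'a set \<Rightarrow> 'a letter list set monoid" where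
  "FIM X = \<lparr>carrier = lists (tilde X) // vagner_rel X,
            mult = (\<lambda>A B. \<Union>a\<in>A. \<Union>b\<in>B. fim_proj X (a @ b)),
            one = fim_proj X []\<rparr>"

definition Geo :: "'a set \<Rightarrow> 'a letter list set" where
  "Geo X = {w \<in> lists (tilde X).
     \<forall>u \<in> lists (tilde X). fim_proj X u = fim_proj X w \<longrightarrow> length w \<le> length u}"

definition ConjGeo :: "'a set \<Rightarrow> 'a letter list set" where
  "ConjGeo X = {w \<in> Geo X. \<forall>u \<in> lists (tilde X).
     conj_class (FIM X) (fim_proj X w) = conj_class (FIM X) (fim_proj X u)
       \<longrightarrow> length w \<le> length u}"


section \<open>Context-free languages\<close>

datatype ('n, 't) symb = Nt 'n | Tm 't

inductive derives :: "('n \<times> ('n, 't) symb list) set \<Rightarrow>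
    ('n, 't) symb list \<Rightarrow> ('n, 't) symb list \<Rightarrow> bool" for P where
  derives_refl: "derives P \<alpha> \<alpha>"
| derives_step: "derives P \<alpha> (\<beta> @ [Nt A] @ \<gamma>) \<Longrightarrow> (A, \<delta>) \<in> P \<Longrightarrow> derives P \<alpha> (\<beta> @ \<delta> @ \<gamma>)"

text \<open>A grammar has a finite set \<open>V\<close> of nonterminals, terminal alphabet \<open>\<Sigma>\<close>, a finite set \<open>P\<close>
  of productions and a start symbol \<open>S\<close>. Since \<open>V\<close> is finite, taking nonterminals to be
  natural numbers is no restriction.\<close>

definition context_free :: "'t set \<Rightarrow> 't list set \<Rightarrow> bool" where
  "context_free \<Sigma> L \<longleftrightarrow> (\<exists>(V :: nat set) P S.
     finite V \<and> finite P \<and> P \<subseteq> V \<times> lists (Nt ` V \<union> Tm ` \<Sigma>) \<and> S \<in> V \<and>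
     L = {w. derives P [Nt S] (map Tm w)})"


section \<open>\<open>FIM X\<close> is an inverse monoid and \<open>fim_proj X\<close> a surjective homomorphism\<close>

lemma letter_inv_inv [simp]: "letter_inv (letter_inv a) = a"
  by (cases a) auto

lemma letter_inv_tilde [simp]: "letter_inv a \<in> tilde X \<longleftrightarrow> a \<in> tilde X"
  by (cases a) (auto simp: tilde_def)

lemma word_inv_inv [simp]: "word_inv (word_inv w) = w"
  by (simp add: word_inv_def rev_map o_def)

lemma word_inv_append [simp]: "word_inv (u @ v) = word_inv v @ word_inv u"
  by (simp add: word_inv_def)

lemma word_inv_lists [simp]: "word_inv w \<in> lists (tilde X) \<longleftrightarrow> w \<in> lists (tilde X)"
  by (auto simp: word_inv_def in_lists_conv_set)

declare vagner.trans [trans]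

lemma vagner_lists:
  assumes "vagner X u v"
  shows "u \<in> lists (tilde X) \<and> v \<in> lists (tilde X)"
  using assms by induction auto

lemma vagner_word_inv:
  assumes "vagner X u v"
  shows "vagner X (word_inv u) (word_inv v)"
  using assms
proof induction
  case (regular u)
  then show ?case using vagner.regular[of "word_inv u" X] by simp
next
  case (commute u v)
  then show ?case using vagner.commute[of v X u] by simp
next
  case (cong u v p q)
  then show ?case using vagner.cong[of X "word_inv u" "word_inv v" "word_inv q" "word_inv p"]
    by simp
next
  case (trans u v w)
  then show ?case by (blast intro: vagner.trans)
qed (simp_all add: vagner.refl vagner.sym)

lemma vagner_append:
  assumes "vagner X u u'" "vagner X v v'"
  shows "vagner X (u @ v) (u' @ v')"
proof -
  have "vagner X (u @ v) (u' @ v)"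
    using vagner.cong[OF assms(1), of "[]" v] vagner_lists[OF assms(2)] by simp
  moreover have "vagner X (u' @ v) (u' @ v')"
    using vagner.cong[OF assms(2), of u' "[]"] vagner_lists[OF assms(1)] by simp
  ultimately show ?thesis by (rule vagner.trans)
qed

lemma fim_proj_eq_iff:
  assumes "u \<in> lists (tilde X)" "v \<in> lists (tilde X)"
  shows "fim_proj X u = fim_proj X v \<longleftrightarrow> vagner X u v"
proof
  assume "fim_proj X u = fim_proj X v"
  moreover have "v \<in> fim_proj X v"
    using assms vagner.refl by (simp add: fim_proj_def vagner_rel_def)
  ultimately have "v \<in> fim_proj X u"
    by simp
  then show "vagner X u v"
    by (simp add: fim_proj_def vagner_rel_def)
next
  assume "vagner X u v"
  then show "fim_proj X u = fim_proj X v"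
    unfolding fim_proj_def vagner_rel_def using vagner.sym vagner.trans by fast
qed

lemma carrier_FIM: "carrier (FIM X) = fim_proj X ` lists (tilde X)"
  by (auto simp: FIM_def quotient_def fim_proj_def)

lemma one_FIM: "\<one>\<^bsub>FIM X\<^esub> = fim_proj X []"
  by (simp add: FIM_def)

lemma mult_FIM:
  assumes "u \<in> lists (tilde X)" "v \<in> lists (tilde X)"
  shows "fim_proj X u \<otimes>\<^bsub>FIM X\<^esub> fim_proj X v = fim_proj X (u @ v)"
proof -
  have "fim_proj X (a @ b) = fim_proj X (u @ v)" if "a \<in> fim_proj X u" "b \<in> fim_proj X v" for a b
  proof -
    from that have *: "vagner X u a" "vagner X v b"
      by (auto simp: fim_proj_def vagner_rel_def)
    then have "a \<in> lists (tilde X)" "b \<in> lists (tilde X)"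
      using vagner_lists by blast+
    then show ?thesis
      using assms vagner.sym[OF vagner_append[OF *]] by (simp add: fim_proj_eq_iff)
  qed
  moreover have "u \<in> fim_proj X u" "v \<in> fim_proj X v"
    using assms by (auto simp: fim_proj_def vagner_rel_def intro: vagner.refl)
  ultimately have "(\<Union>a\<in>fim_proj X u. \<Union>b\<in>fim_proj X v. fim_proj X (a @ b)) = fim_proj X (u @ v)"
    by blast
  then show ?thesis
    by (simp add: FIM_def)
qed

lemma monoid_FIM: "monoid (FIM X)"
proof (rule monoidI)
  fix a b c assume "a \<in> carrier (FIM X)" "b \<in> carrier (FIM X)" "c \<in> carrier (FIM X)"
  then obtain u v w where uvw: "u \<in> lists (tilde X)" "v \<in> lists (tilde X)" "w \<in> lists (tilde X)"
    and eq: "a = fim_proj X u" "b = fim_proj X v" "c = fim_proj X w"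
    unfolding carrier_FIM by blast
  show "a \<otimes>\<^bsub>FIM X\<^esub> b \<otimes>\<^bsub>FIM X\<^esub> c = a \<otimes>\<^bsub>FIM X\<^esub> (b \<otimes>\<^bsub>FIM X\<^esub> c)"
    using uvw by (simp add: eq mult_FIM)
  have "u @ v \<in> lists (tilde X)" using uvw by simp
  then show "a \<otimes>\<^bsub>FIM X\<^esub> b \<in> carrier (FIM X)"
    using uvw unfolding eq carrier_FIM by (simp only: mult_FIM) blast
next
  fix a assume "a \<in> carrier (FIM X)"
  then obtain u where "u \<in> lists (tilde X)" "a = fim_proj X u"
    unfolding carrier_FIM by blast
  then show "\<one>\<^bsub>FIM X\<^esub> \<otimes>\<^bsub>FIM X\<^esub> a = a" "a \<otimes>\<^bsub>FIM X\<^esub> \<one>\<^bsub>FIM X\<^esub> = a"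
    by (simp_all add: one_FIM mult_FIM)
qed (simp add: one_FIM carrier_FIM)

lemma vagner_idem:
  assumes "vagner X (e @ e) e"
  shows "vagner X e (e @ word_inv e)"
proof -
  let ?f = "word_inv e"
  have e: "e \<in> lists (tilde X)" "?f \<in> lists (tilde X)" using vagner_lists[OF assms] by auto
  have ff: "vagner X (?f @ ?f) ?f" using vagner_word_inv[OF assms] by simp
  have "vagner X ?f (?f @ e @ ?f)"
    using vagner.sym[OF vagner.regular[of ?f X]] e by simp
  also have "vagner X \<dots> (?f @ (e @ e) @ ?f)"
    using vagner.cong[OF vagner.sym[OF assms], of ?f ?f] e by simp
  also have "vagner X \<dots> (e @ ?f @ ?f @ e)"
    using vagner.commute[of ?f X e] e by simp
  also have "vagner X \<dots> (e @ ?f @ e)"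
    using vagner.cong[OF ff, of e e] e by simp
  also have "vagner X \<dots> e"
    using vagner.regular[of e X] e by simp
  finally have fe: "vagner X ?f e" .
  have "vagner X e (e @ e)" by (rule vagner.sym[OF assms])
  also have "vagner X \<dots> (e @ ?f)"
    using vagner_append[OF vagner.refl[OF e(1)] vagner.sym[OF fe]] .
  finally show ?thesis .
qed

lemma is_inverse_FIM:
  assumes "u \<in> lists (tilde X)"
  shows "is_inverse (FIM X) (fim_proj X u) (fim_proj X (word_inv u))"
  using assms vagner.regular[of u X] vagner.regular[of "word_inv u" X]
  by (simp add: is_inverse_def carrier_FIM mult_FIM fim_proj_eq_iff)

lemma idem_commute_FIM:
  assumes "e \<in> carrier (FIM X)" "f \<in> carrier (FIM X)"
    and "e \<otimes>\<^bsub>FIM X\<^esub> e = e" "f \<otimes>\<^bsub>FIM X\<^esub> f = f"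
  shows "e \<otimes>\<^bsub>FIM X\<^esub> f = f \<otimes>\<^bsub>FIM X\<^esub> e"
proof -
  obtain u v where uv: "u \<in> lists (tilde X)" "v \<in> lists (tilde X)"
      "e = fim_proj X u" "f = fim_proj X v"
    using assms unfolding carrier_FIM by blast
  have u: "vagner X u (u @ word_inv u)" and v: "vagner X v (v @ word_inv v)"
    using assms(3,4) uv by (simp_all add: mult_FIM fim_proj_eq_iff vagner_idem)
  have "vagner X (u @ v) (u @ word_inv u @ v @ word_inv v)"
    using vagner_append[OF u v] by simp
  also have "vagner X \<dots> (v @ word_inv v @ u @ word_inv u)"
    using vagner.commute uv by blast
  also have "vagner X \<dots> (v @ u)"
    using vagner.sym[OF vagner_append[OF v u]] by simp
  finally show ?thesis
    using uv by (simp add: mult_FIM fim_proj_eq_iff)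
qed

lemma inverse_monoid_FIM: "inverse_monoid (FIM X)"
proof -
  interpret monoid "FIM X" by (rule monoid_FIM)
  have uniq: "b = c"
    if a: "a \<in> carrier (FIM X)" and b: "is_inverse (FIM X) a b" and c: "is_inverse (FIM X) a c"
    for a b c
  proof -
    let ?m = "\<lambda>x y. x \<otimes>\<^bsub>FIM X\<^esub> y"
    have B: "b \<in> carrier (FIM X)" "?m a (?m b a) = a" "?m b (?m a b) = b"
      and C: "c \<in> carrier (FIM X)" "?m a (?m c a) = a" "?m c (?m a c) = c"
      using a b c by (auto simp: is_inverse_def simp flip: m_assoc)
    have id: "?m (?m a d) (?m a d) = ?m a d" "?m (?m d a) (?m d a) = ?m d a"
      if "d \<in> carrier (FIM X)" "?m a (?m d a) = a" "?m d (?m a d) = d" for d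
      using a that by (simp_all add: m_assoc)
    have l: "?m (?m a b) (?m a c) = ?m (?m a c) (?m a b)"
      and r: "?m (?m b a) (?m c a) = ?m (?m c a) (?m b a)"
      using a B(1) C(1) by (simp_all add: idem_commute_FIM[OF _ _ id(1)[OF B] id(1)[OF C]]
        idem_commute_FIM[OF _ _ id(2)[OF B] id(2)[OF C]])
    have "?m a b = ?m (?m a (?m c a)) b" using C(2) by simp
    also have "\<dots> = ?m (?m a c) (?m a b)" using a B(1) C(1) by (simp add: m_assoc)
    also have "\<dots> = ?m (?m a b) (?m a c)" using l by simp
    also have "\<dots> = ?m (?m a (?m b a)) c" using a B(1) C(1) by (simp add: m_assoc)
    also have "\<dots> = ?m a c" using B(2) by simp
    finally have ab: "?m a b = ?m a c" .
    have "?m b a = ?m b (?m a (?m c a))" using C(2) by simp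
    also have "\<dots> = ?m (?m b a) (?m c a)" using a B(1) C(1) by (simp add: m_assoc)
    also have "\<dots> = ?m (?m c a) (?m b a)" using r by simp
    also have "\<dots> = ?m c (?m a (?m b a))" using a B(1) C(1) by (simp add: m_assoc)
    also have "\<dots> = ?m c a" using B(2) by simp
    finally have ba: "?m b a = ?m c a" .
    have "b = ?m b (?m a c)" using B(3) ab by simp
    also have "\<dots> = ?m (?m b a) c" using a B(1) C(1) by (simp add: m_assoc)
    also have "\<dots> = ?m c (?m a c)" using ba a C(1) by (simp add: m_assoc)
    also have "\<dots> = c" using C(3) by simp
    finally show ?thesis .
  qed
  have "\<exists>b. is_inverse (FIM X) a b" if "a \<in> carrier (FIM X)" for a
    using that is_inverse_FIM unfolding carrier_FIM by blast
  then show ?thesis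
    unfolding inverse_monoid_def using monoid_FIM uniq by blast
qed

lemma sinv_FIM:
  assumes "u \<in> lists (tilde X)"
  shows "sinv (FIM X) (fim_proj X u) = fim_proj X (word_inv u)"
proof -
  have "\<exists>!b. is_inverse (FIM X) (fim_proj X u) b"
    using inverse_monoid_FIM[of X] assms by (simp add: inverse_monoid_def carrier_FIM)
  then show ?thesis
    unfolding sinv_def using is_inverse_FIM[OF assms] by (rule the1_equality)
qed

end

theory Submission
  imports Defs "HOL-Library.Multiset"
begin

text \<open>Consider the words \<open>w = y\<^sup>i y\<^sup>-\<^sup>n x y\<^sup>m y\<^sup>-\<^sup>l\<close> with \<open>n \<le> i\<close> and \<open>m \<le> l\<close>. The Munn tree of \<open>w\<close> has
  \<open>i + l + 1\<close> edges, and every conjugate of \<open>w\<close> labels a walk through the whole tree between two points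
  \<open>h\<close> and \<open>h'\<close> obtained by moving both end points of \<open>w\<close> by the same group element. Such a walk has
  length at least twice the number of edges minus the distance from \<open>h\<close> to \<open>h'\<close>, and that distance is
  largest at the end points of \<open>w\<close> exactly if \<open>n + m \<le> max i l\<close>. Hence the complement of the
  language contains \<open>w\<close> if and only if \<open>max i l < n + m\<close>. For \<open>n = m\<close> large and \<open>i = l = n + m - 1\<close>
  this cannot be pumped: a short factor meets at most two adjacent blocks, so pumping down
  decreases \<open>n + m\<close> but not both of \<open>i\<close> and \<open>l\<close>, and if \<open>n\<close> and \<open>m\<close> are not affected, pumping up
  increases \<open>i\<close> or \<open>l\<close>.\<close>

section \<open>A pumping lemma\<close>

text \<open>Branching is arbitrary and \<open>Node A []\<close> stands for an erasing production, so
  grammars are handled directly, without a normal form.\<close>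

datatype ('n, 't) ptree = Leaf 't | Node 'n "('n, 't) ptree list"

fun root :: "('n, 't) ptree \<Rightarrow> ('n, 't) symb" where
  "root (Leaf a) = Tm a"
| "root (Node A ts) = Nt A"

fun yield :: "('n, 't) ptree \<Rightarrow> 't list" where
  "yield (Leaf a) = [a]"
| "yield (Node A ts) = concat (map yield ts)"

fun height :: "('n, 't) ptree \<Rightarrow> nat" where
  "height (Leaf a) = 0"
| "height (Node A ts) = Suc (Max (set (0 # map height ts)))"

fun valid :: "('n \<times> ('n, 't) symb list) set \<Rightarrow> ('n, 't) ptree \<Rightarrow> bool" where
  "valid P (Leaf a) = True"
| "valid P (Node A ts) = ((A, map root ts) \<in> P \<and> (\<forall>t\<in>set ts. valid P t))"

section \<open>Derivations and parse trees\<close>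

lemma derives_trans:
  assumes "derives P \<beta> \<gamma>" "derives P \<alpha> \<beta>"
  shows "derives P \<alpha> \<gamma>"
  using assms by (induction) (auto intro: derives_step)

lemma derives_context:
  assumes "derives P \<alpha> \<beta>"
  shows "derives P (p @ \<alpha> @ q) (p @ \<beta> @ q)"
  using assms
proof induction
  case (derives_step \<alpha> \<beta> A \<gamma> \<delta>)
  then show ?case
    using derives.derives_step[of P "p @ \<alpha> @ q" "p @ \<beta>" A "\<gamma> @ q" \<delta>] by simp
qed (rule derives_refl)

lemma derives_append:
  assumes "derives P \<alpha> \<alpha>'" "derives P \<beta> \<beta>'"
  shows "derives P (\<alpha> @ \<beta>) (\<alpha>' @ \<beta>')"
  using derives_trans[OF derives_context[OF assms(2), of "\<alpha>'" "[]"]]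
    derives_context[OF assms(1), of "[]" \<beta>] by simp

lemma valid_derives:
  assumes "valid P t"
  shows "derives P [root t] (map Tm (yield t))"
  using assms
proof (induction t)
  case (Node A ts)
  have "derives P (map root ts') (map Tm (concat (map yield ts')))" if "set ts' \<subseteq> set ts" for ts'
    using that
  proof (induction ts')
    case (Cons t ts')
    then show ?case
      using derives_append[of P "[root t]" "map Tm (yield t)" "map root ts'"] Node by auto
  qed (simp add: derives_refl)
  moreover have "derives P [Nt A] (map root ts)"
    using derives_step[of P "[Nt A]" "[]" A "[]" "map root ts"] derives_refl[of P "[Nt A]"] Node.prems
    by simp
  ultimately show ?case by (auto intro: derives_trans)
qed (simp add: derives_refl)

text \<open>Undoing the last derivation step joins the trees over the inserted right-hand side under
  one new node; the yield stays the same.\<close>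

lemma derives_forest:
  assumes "derives P \<alpha> \<beta>" "\<beta> = map root ts" "\<forall>t\<in>set ts. valid P t"
  shows "\<exists>ts'. \<alpha> = map root ts' \<and> (\<forall>t\<in>set ts'. valid P t) \<and>
    concat (map yield ts') = concat (map yield ts)"
  using assms
proof (induction arbitrary: ts)
  case (derives_step \<alpha> \<beta> A \<gamma> \<delta>)
  obtain t1 t2 t3 where ts: "ts = t1 @ t2 @ t3" "\<beta> = map root t1" "\<delta> = map root t2" "\<gamma> = map root t3"
    using derives_step.prems(1) by (auto simp: map_eq_append_conv append_eq_map_conv)
  have "\<beta> @ [Nt A] @ \<gamma> = map root (t1 @ [Node A t2] @ t3)"
    using ts by simp
  moreover have "\<forall>t\<in>set (t1 @ [Node A t2] @ t3). valid P t"
    using derives_step.prems(2) derives_step.hyps(2) ts by auto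
  ultimately show ?case
    using derives_step.IH[of "t1 @ [Node A t2] @ t3"] ts(1) by simp
qed auto

lemma derives_iff_ptree:
  "derives P [Nt S] (map Tm w) \<longleftrightarrow> (\<exists>t. valid P t \<and> root t = Nt S \<and> yield t = w)"
proof
  assume d: "derives P [Nt S] (map Tm w)"
  have "concat (map yield (map Leaf w)) = w" by (induction w) auto
  moreover have "map Tm w = map root (map Leaf w)" "\<forall>t\<in>set (map Leaf w). valid P t" by auto
  ultimately obtain ts where "[Nt S] = map root ts" "\<forall>t\<in>set ts. valid P t" "concat (map yield ts) = w"
    using derives_forest[OF d] by metis
  then show "\<exists>t. valid P t \<and> root t = Nt S \<and> yield t = w" by auto
qed (metis valid_derives)

text \<open>The position of \<open>t'\<close> inside \<open>t\<close> is recorded only by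
  \<open>u\<close> and \<open>z\<close>, the words produced to its left and right.\<close>

inductive subtree :: "('n, 't) ptree \<Rightarrow> 't list \<Rightarrow> ('n, 't) ptree \<Rightarrow> 't list \<Rightarrow> bool" where
  subtree_refl: "subtree t [] t []"
| subtree_child: "subtree t u t' z \<Longrightarrow>
    subtree (Node A (l @ t # r)) (concat (map yield l) @ u) t' (z @ concat (map yield r))"

lemma subtree_yield: "subtree t u t' z \<Longrightarrow> yield t = u @ yield t' @ z"
  by (induction rule: subtree.induct) auto

lemma subtree_valid: "subtree t u t' z \<Longrightarrow> valid P t \<Longrightarrow> valid P t'"
  by (induction rule: subtree.induct) auto

lemma subtree_size_le: "subtree t u t' z \<Longrightarrow> size t' \<le> size t"
  by (induction rule: subtree.induct) auto

text \<open>The size equation shows that inserting a smaller tree shrinks the whole; stated as a sum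
  it avoids truncated subtraction.\<close>

lemma subtree_replace:
  assumes "subtree t u t' z" "valid P t" "valid P s'" "root s' = root t'"
  shows "\<exists>s. valid P s \<and> root s = root t \<and> yield s = u @ yield s' @ z \<and>
    size s + size t' = size t + size s'"
  using assms
proof (induction rule: subtree.induct)
  case (subtree_refl t)
  then show ?case by auto
next
  case (subtree_child t u t' z A l r)
  then obtain s where "valid P s" "root s = root t" "yield s = u @ yield s' @ z"
    "size s + size t' = size t + size s'" by auto
  then show ?case using subtree_child.prems
    by (intro exI[of _ "Node A (l @ s # r)"]) auto
qed

text \<open>Since the roots agree, the tree built so far can take the place of \<open>t'\<close>
  inside \<open>t\<close>, which adds one more \<open>v\<close> and \<open>y\<close>.\<close>

lemma subtree_pump:
  assumes "subtree t v t' y" "root t = root t'" "valid P t"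
  shows "\<exists>s. valid P s \<and> root s = root t \<and>
    yield s = concat (replicate i v) @ yield t' @ concat (replicate i y)"
proof (induction i)
  case 0
  show ?case using subtree_valid[OF assms(1,3)] assms(2) by auto
next
  case (Suc i)
  then obtain s where s: "valid P s" "root s = root t"
    "yield s = concat (replicate i v) @ yield t' @ concat (replicate i y)" by blast
  have "concat (replicate i y) @ y = y @ concat (replicate i y)"
    by (induction i) auto
  with subtree_replace[OF assms(1,3) s(1)] s assms(2) show ?case by force
qed

section \<open>Height, yield length and a deepest path\<close>

lemma length_yield_le:
  assumes "valid P t" "\<And>A \<delta>. (A, \<delta>) \<in> P \<Longrightarrow> length \<delta> \<le> b"
  shows "length (yield t) \<le> b ^ height t"
  using assms(1)
proof (induction t)
  case (Node A ts)
  let ?h = "Max (set (0 # map height ts))"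
  show ?case
  \<comment> \<open>A childless node yields the empty word, within the bound even for
    \<open>b = 0\<close>; a child forces \<open>1 <= b\<close>, which makes powers monotone.\<close>
  proof (cases "ts = []")
    case False
    have len: "length ts \<le> b" using Node.prems assms(2)[of A "map root ts"] by simp
    with False have b: "1 \<le> b" by (cases ts) auto
    have "length (yield t) \<le> b ^ ?h" if "t \<in> set ts" for t
    proof -
      have "height t \<le> ?h" using that by (intro Max_ge) auto
      then have "b ^ height t \<le> b ^ ?h" using b by (rule power_increasing)
      then show ?thesis using Node that by fastforce
    qed
    then have "(\<Sum>t\<leftarrow>ts. length (yield t)) \<le> (\<Sum>t\<leftarrow>ts. b ^ ?h)"
      by (intro sum_list_mono) auto
    also have "\<dots> = length ts * b ^ ?h" by (simp add: sum_list_triv)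
    also have "\<dots> \<le> b * b ^ ?h" using len by simp
    finally show ?thesis by (simp add: length_concat o_def)
  qed auto
qed auto

text \<open>Following children of greatest height gives a chain, listed from the bottom so that
  entry \<open>j\<close> has height \<open>j + 1\<close>. Entries of small index thus have short
  yields.\<close>

lemma deepest_path:
  "\<exists>ts. length ts = height t \<and> (\<forall>j<height t. height (ts ! j) = Suc j \<and> (\<exists>A l. ts ! j = Node A l) \<and>
     (\<exists>u z. subtree t u (ts ! j) z)) \<and>
   (\<forall>j k. j < k \<longrightarrow> k < height t \<longrightarrow>
      (\<exists>u z. subtree (ts ! k) u (ts ! j) z) \<and> size (ts ! j) < size (ts ! k))"
proof (induction t)
  case (Node A ts)
  have "Max (set (0 # map height ts)) \<in> set (0 # map height ts)"
    by (rule Max_in) auto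
  then consider "height (Node A ts) = 1" |
    t where "t \<in> set ts" "height (Node A ts) = Suc (height t)" by fastforce
  then show ?case
  proof cases
    case 1
    then show ?thesis
      by (intro exI[of _ "[Node A ts]"]) (auto intro: subtree_refl)
  next
    case 2
    let ?t = "Node A ts"
    obtain l r where lr: "ts = l @ t # r" using 2(1) split_list by fast
    have sub: "\<exists>u z. subtree ?t u t' z" if "subtree t u t' z" for u t' z
      using subtree_child[OF that] lr by blast
    have size: "size t' < size ?t" if "subtree t u t' z" for u t' z
      using subtree_size_le[OF that] lr by simp
    obtain c where c: "length c = height t"
      "\<And>j. j < height t \<Longrightarrow>
        height (c ! j) = Suc j \<and> (\<exists>A l. c ! j = Node A l) \<and> (\<exists>u z. subtree t u (c ! j) z)"
      "\<And>j k. j < k \<Longrightarrow> k < height t \<Longrightarrow>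
        (\<exists>u z. subtree (c ! k) u (c ! j) z) \<and> size (c ! j) < size (c ! k)"
      using Node[OF 2(1)] by blast
    have nth: "(c @ [?t]) ! j = c ! j" if "j < height t" for j
      using that c(1) by (simp add: nth_append)
    have last: "(c @ [?t]) ! height t = ?t" using c(1) by (metis nth_append_length)
    have pair: "(\<exists>u z. subtree ((c @ [?t]) ! k) u ((c @ [?t]) ! j) z) \<and>
        size ((c @ [?t]) ! j) < size ((c @ [?t]) ! k)" if "j < k" "k < Suc (height t)" for j k
    proof (cases "k < height t")
      case True
      then show ?thesis using c(3)[OF that(1) True] nth[OF True] nth[of j] that(1) by simp
    next
      case False
      then have k: "k = height t" "j < height t" using that by auto
      obtain u z where "subtree t u (c ! j) z" using c(2)[OF k(2)] by blast
      then show ?thesis unfolding k(1) last nth[OF k(2)] using sub size by blast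
    qed
    have single: "height ((c @ [?t]) ! j) = Suc j \<and> (\<exists>A' l. (c @ [?t]) ! j = Node A' l) \<and>
        (\<exists>u z. subtree ?t u ((c @ [?t]) ! j) z)" if "j < Suc (height t)" for j
    proof (cases "j < height t")
      case True
      obtain u z where "subtree t u (c ! j) z" using c(2)[OF True] by blast
      then show ?thesis unfolding nth[OF True] using sub c(2)[OF True] by blast
    next
      case False
      then have "j = height t" using that by simp
      then show ?thesis unfolding \<open>j = height t\<close> last 2(2) using subtree_refl[of ?t] by blast
    qed
    show ?thesis
      unfolding 2(2) using c(1) single pair by (intro exI[of _ "c @ [?t]"] conjI allI impI) simp_all
  qed
qed auto

text \<open>The usual pumping lemma, except that the pigeonhole principle is applied to the label of a
  node together with the value of \<open>f\<close> at its yield. It plays the role of an intersection with a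
  regular language.\<close>

lemma pumping:
  fixes f :: "'t list \<Rightarrow> 'c"
  assumes "context_free \<Sigma> L" "finite (range f)"
  shows "\<exists>p. \<forall>w\<in>L. p < length w \<longrightarrow> (\<exists>u v x y z. w = u @ v @ x @ y @ z \<and> v @ y \<noteq> [] \<and>
    length (v @ x @ y) \<le> p \<and> f (v @ x @ y) = f x \<and>
    (\<forall>i. u @ concat (replicate i v) @ x @ concat (replicate i y) @ z \<in> L))"
proof -
  obtain V :: "nat set" and P S where G: "finite V" "finite P"
    "P \<subseteq> V \<times> lists (Nt ` V \<union> Tm ` \<Sigma>)" "L = {w. derives P [Nt S] (map Tm w)}"
    using assms(1) unfolding context_free_def by blast
  define b where "b = Max (insert 1 (length ` snd ` P))"
  have fin: "finite (insert 1 (length ` snd ` P))" using G(2) by simp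
  have b: "length \<delta> \<le> b" if "(A, \<delta>) \<in> P" for A \<delta>
  proof -
    have "\<delta> \<in> snd ` P" using image_eqI[of \<delta> snd "(A, \<delta>)"] that by simp
    then show ?thesis unfolding b_def using fin by (intro Max_ge) blast+
  qed
  have b1: "1 \<le> b" unfolding b_def using fin by (rule Max_ge) (rule insertI1)
  \<comment> \<open>\<open>K\<close> counts the possible pairs of label and value of
    \<open>f\<close>. The lowest \<open>K + 1\<close> nodes of a deepest path have height at most
    \<open>K + 1\<close>, hence the exponent in \<open>p\<close>.\<close>
  define K where "K = card (V \<times> range f)"
  define p where "p = b ^ Suc K"
  have "\<exists>u v x y z. w = u @ v @ x @ y @ z \<and> v @ y \<noteq> [] \<and>
    length (v @ x @ y) \<le> p \<and> f (v @ x @ y) = f x \<and>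
    (\<forall>i. u @ concat (replicate i v) @ x @ concat (replicate i y) @ z \<in> L)"
    if w: "w \<in> L" "p < length w" for w
  proof -
    let ?T = "\<lambda>t. valid P t \<and> root t = Nt S \<and> yield t = w"
    have "\<exists>t. ?T t" using w(1) unfolding G(4) mem_Collect_eq derives_iff_ptree .
    then obtain t0 where "?T t0" ..
    \<comment> \<open>Least size excludes \<open>v @ y = []\<close>: otherwise the upper tree could
      be replaced by the lower one without changing \<open>w\<close>.\<close>
    from ex_has_least_nat[of ?T, OF this, of size] obtain t where
      T: "?T t" and least: "\<And>s. ?T s \<Longrightarrow> size t \<le> size s" by blast
    from T have t: "valid P t" "root t = Nt S" "yield t = w" by auto
    have h: "Suc K < height t"
    proof (rule ccontr)
      assume "\<not> Suc K < height t"
      then have "b ^ height t \<le> p" unfolding p_def using b1 by (intro power_increasing) auto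
      with length_yield_le[OF t(1) b] w t show False by simp
    qed
    obtain c where c: "length c = height t"
      "\<And>j. j < height t \<Longrightarrow> height (c ! j) = Suc j \<and> (\<exists>A l. c ! j = Node A l) \<and> (\<exists>u z. subtree t u (c ! j) z)"
      "\<And>j k. j < k \<Longrightarrow> k < height t \<Longrightarrow>
        (\<exists>u z. subtree (c ! k) u (c ! j) z) \<and> size (c ! j) < size (c ! k)"
      using deepest_path[of t] by blast
    have "\<exists>A\<in>V. root (c ! j) = Nt A" if "j < height t" for j
    proof -
      have "valid P (c ! j)" using c(2)[OF that] t(1) subtree_valid by blast
      then show ?thesis using c(2)[OF that] G(3) by force
    qed
    \<comment> \<open>Pigeonhole: the \<open>K + 1\<close> lowest nodes carry at most
      \<open>K\<close> different pairs.\<close>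
    then have "(\<lambda>j. (root (c ! j), f (yield (c ! j)))) ` {..K} \<subseteq> (\<lambda>(A, r). (Nt A, r)) ` (V \<times> range f)"
      using h by (fastforce simp: image_iff)
    moreover have fin: "finite (V \<times> range f)" using G(1) assms(2) by blast
    ultimately have "card ((\<lambda>j. (root (c ! j), f (yield (c ! j)))) ` {..K}) \<le> K"
      unfolding K_def by (rule surj_card_le[rotated])
    then have "\<not> inj_on (\<lambda>j. (root (c ! j), f (yield (c ! j)))) {..K}"
      using card_image by fastforce
    then obtain j k where jk: "j < k" "k \<le> K" "root (c ! j) = root (c ! k)"
      "f (yield (c ! j)) = f (yield (c ! k))"
      unfolding inj_on_def by (metis atMost_iff linorder_neqE_nat prod.inject)
    obtain v y where vy: "subtree (c ! k) v (c ! j) y" using c(3)[of j k] jk h by auto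
    obtain u z where uz: "subtree t u (c ! k) z" using c(2)[of k] jk h by auto
    have valid: "valid P (c ! k)" "valid P (c ! j)" using subtree_valid uz vy t(1) by blast+
    let ?x = "yield (c ! j)"
    have yk: "yield (c ! k) = v @ ?x @ y" using subtree_yield[OF vy] .
    have w_eq: "w = u @ v @ ?x @ y @ z" using subtree_yield[OF uz] t(3) yk by simp
    have "length (v @ ?x @ y) \<le> b ^ height (c ! k)"
      using length_yield_le[OF valid(1) b] yk by simp
    also have "\<dots> \<le> p" unfolding p_def using b1 c(2)[of k] jk h by (intro power_increasing) auto
    finally have len: "length (v @ ?x @ y) \<le> p" .
    have ne: "v @ y \<noteq> []"
    proof
      assume "v @ y = []"
      then obtain s where "valid P s" "root s = root t" "yield s = w"
        "size s + size (c ! k) = size t + size (c ! j)"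
        using subtree_replace[OF uz t(1) valid(2)] jk w_eq by auto
      then show False using least[of s] t c(3)[of j k] jk h by simp
    qed
    have "u @ concat (replicate i v) @ ?x @ concat (replicate i y) @ z \<in> L" for i
    proof -
      obtain s where "valid P s" "root s = root (c ! k)"
        "yield s = concat (replicate i v) @ ?x @ concat (replicate i y)"
        using subtree_pump[OF vy _ valid(1)] jk by auto
      with subtree_replace[OF uz t(1)] obtain s' where "valid P s'" "root s' = root t"
        "yield s' = u @ concat (replicate i v) @ ?x @ concat (replicate i y) @ z"
        by (metis append.assoc)
      then show ?thesis using G(4) t(2) derives_iff_ptree by force
    qed
    with w_eq ne len jk yk show ?thesis by metis
  qed
  then show ?thesis by blast
qed

section \<open>Conjugacy in terms of words\<close>

lemma i_conj_FIM:
  assumes "u \<in> lists (tilde X)" "v \<in> lists (tilde X)"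
  shows "i_conj (FIM X) (fim_proj X u) (fim_proj X v) \<longleftrightarrow>
    (\<exists>g\<in>lists (tilde X). vagner X (word_inv g @ u @ g) v \<and> vagner X (g @ v @ word_inv g) u)"
proof -
  have "sinv (FIM X) (fim_proj X g) \<otimes>\<^bsub>FIM X\<^esub> fim_proj X u \<otimes>\<^bsub>FIM X\<^esub> fim_proj X g = fim_proj X v \<longleftrightarrow>
      vagner X (word_inv g @ u @ g) v"
    "fim_proj X g \<otimes>\<^bsub>FIM X\<^esub> fim_proj X v \<otimes>\<^bsub>FIM X\<^esub> sinv (FIM X) (fim_proj X g) = fim_proj X u \<longleftrightarrow>
      vagner X (g @ v @ word_inv g) u" if "g \<in> lists (tilde X)" for g
  proof -
    have "word_inv g \<in> lists (tilde X)" "word_inv g @ u \<in> lists (tilde X)" "g @ v \<in> lists (tilde X)"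
      "word_inv g @ u @ g \<in> lists (tilde X)" "g @ v @ word_inv g \<in> lists (tilde X)"
      using that assms by auto
    then show "sinv (FIM X) (fim_proj X g) \<otimes>\<^bsub>FIM X\<^esub> fim_proj X u \<otimes>\<^bsub>FIM X\<^esub> fim_proj X g = fim_proj X v \<longleftrightarrow>
      vagner X (word_inv g @ u @ g) v"
    "fim_proj X g \<otimes>\<^bsub>FIM X\<^esub> fim_proj X v \<otimes>\<^bsub>FIM X\<^esub> sinv (FIM X) (fim_proj X g) = fim_proj X u \<longleftrightarrow>
      vagner X (g @ v @ word_inv g) u"
      using that assms by (simp_all only: sinv_FIM mult_FIM fim_proj_eq_iff append.assoc)
  qed
  then show ?thesis unfolding i_conj_def carrier_FIM by auto
qed

lemma i_conj_FIM_sym: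
  assumes "i_conj (FIM X) a b" "a \<in> carrier (FIM X)" "b \<in> carrier (FIM X)"
  shows "i_conj (FIM X) b a"
proof -
  obtain u v where uv: "u \<in> lists (tilde X)" "v \<in> lists (tilde X)" "a = fim_proj X u" "b = fim_proj X v"
    using assms(2,3) unfolding carrier_FIM by blast
  then obtain g where "g \<in> lists (tilde X)" "vagner X (word_inv g @ u @ g) v"
    "vagner X (g @ v @ word_inv g) u"
    using assms(1) i_conj_FIM by metis
  then have "\<exists>h\<in>lists (tilde X). vagner X (word_inv h @ v @ h) u \<and> vagner X (h @ u @ word_inv h) v"
    by (intro bexI[of _ "word_inv g"] conjI) (simp_all only: word_inv_lists word_inv_inv)
  then show ?thesis using uv by (simp only: i_conj_FIM)
qed

lemma i_conj_FIM_trans: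
  assumes "i_conj (FIM X) a b" "i_conj (FIM X) b c"
    and "a \<in> carrier (FIM X)" "b \<in> carrier (FIM X)" "c \<in> carrier (FIM X)"
  shows "i_conj (FIM X) a c"
proof -
  obtain u v w where uvw: "u \<in> lists (tilde X)" "v \<in> lists (tilde X)" "w \<in> lists (tilde X)"
    "a = fim_proj X u" "b = fim_proj X v" "c = fim_proj X w"
    using assms(3-5) unfolding carrier_FIM by blast
  obtain g where g: "g \<in> lists (tilde X)" "vagner X (word_inv g @ u @ g) v"
    "vagner X (g @ v @ word_inv g) u"
    using assms(1) unfolding uvw(4,5) i_conj_FIM[OF uvw(1,2)] by blast
  obtain h where h: "h \<in> lists (tilde X)" "vagner X (word_inv h @ v @ h) w"
    "vagner X (h @ w @ word_inv h) v"
    using assms(2) unfolding uvw(5,6) i_conj_FIM[OF uvw(2,3)] by blast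
  have "vagner X (word_inv h @ (word_inv g @ u @ g) @ h) w"
    using vagner.trans[OF vagner.cong[OF g(2)] h(2)] h(1) by simp
  moreover have "vagner X (g @ (h @ w @ word_inv h) @ word_inv g) u"
    using vagner.trans[OF vagner.cong[OF h(3)] g(3)] g(1) by simp
  moreover have "g @ h \<in> lists (tilde X)" using g(1) h(1) by simp
  ultimately have "\<exists>g\<in>lists (tilde X). vagner X (word_inv g @ u @ g) w \<and> vagner X (g @ w @ word_inv g) u"
    by (intro bexI[of _ "g @ h"] conjI) (simp_all only: word_inv_append append.assoc)
  then show ?thesis using uvw by (simp only: i_conj_FIM)
qed

lemma conj_class_FIM_eq_iff:
  assumes "a \<in> carrier (FIM X)" "b \<in> carrier (FIM X)"
  shows "conj_class (FIM X) a = conj_class (FIM X) b \<longleftrightarrow> i_conj (FIM X) a b"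
proof
  obtain v where v: "v \<in> lists (tilde X)" "b = fim_proj X v"
    using assms unfolding carrier_FIM by blast
  have "\<exists>g\<in>lists (tilde X). vagner X (word_inv g @ v @ g) v \<and> vagner X (g @ v @ word_inv g) v"
    using vagner.refl[OF v(1)] by (intro bexI[of _ "[]"]) (simp_all add: word_inv_def)
  then have "i_conj (FIM X) b b" unfolding v(2) i_conj_FIM[OF v(1,1)] .
  then show "conj_class (FIM X) a = conj_class (FIM X) b \<Longrightarrow> i_conj (FIM X) a b"
    using assms by (auto simp: conj_class_def)
next
  assume "i_conj (FIM X) a b"
  then show "conj_class (FIM X) a = conj_class (FIM X) b"
    using assms i_conj_FIM_sym i_conj_FIM_trans unfolding conj_class_def by blast
qed

text \<open>Words with the same value have the same class, so membership in \<open>Geo X\<close>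
  follows from minimality within the class.\<close>

lemma ConjGeo_iff:
  "w \<in> ConjGeo X \<longleftrightarrow> w \<in> lists (tilde X) \<and> (\<forall>u\<in>lists (tilde X). \<forall>g\<in>lists (tilde X).
     vagner X (word_inv g @ w @ g) u \<longrightarrow> vagner X (g @ u @ word_inv g) w \<longrightarrow> length w \<le> length u)"
proof (cases "w \<in> lists (tilde X)")
  case True
  have conj: "conj_class (FIM X) (fim_proj X w) = conj_class (FIM X) (fim_proj X u) \<longleftrightarrow>
    (\<exists>g\<in>lists (tilde X). vagner X (word_inv g @ w @ g) u \<and> vagner X (g @ u @ word_inv g) w)"
    if "u \<in> lists (tilde X)" for u
    using that True by (simp add: conj_class_FIM_eq_iff carrier_FIM i_conj_FIM del: in_lists_conv_set)
  have "w \<in> ConjGeo X \<longleftrightarrow> (\<forall>u\<in>lists (tilde X).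
      conj_class (FIM X) (fim_proj X w) = conj_class (FIM X) (fim_proj X u) \<longrightarrow> length w \<le> length u)"
    (is "_ \<longleftrightarrow> ?R")
  proof
    assume R: ?R
    have "length w \<le> length u" if "u \<in> lists (tilde X)" "fim_proj X u = fim_proj X w" for u
      using bspec[OF R that(1)] that(2) by simp
    with R show "w \<in> ConjGeo X" unfolding ConjGeo_def Geo_def using True by blast
  qed (simp add: ConjGeo_def)
  also have "?R \<longleftrightarrow> (\<forall>u\<in>lists (tilde X). \<forall>g\<in>lists (tilde X).
     vagner X (word_inv g @ w @ g) u \<longrightarrow> vagner X (g @ u @ word_inv g) w \<longrightarrow> length w \<le> length u)"
    by (rule ball_cong[OF HOL.refl], subst conj) blast+
  finally show ?thesis using True by blast
qed (auto simp: ConjGeo_def Geo_def)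

text \<open>The idempotents of \<open>p\<close> and \<open>q\<close> commute, which moves
  \<open>q @ word_inv q\<close> next to the leading \<open>word_inv q\<close>, where regularity
  absorbs it.\<close>

lemma vagner_absorb:
  assumes "p \<in> lists (tilde X)" "q \<in> lists (tilde X)"
  shows "vagner X (word_inv q @ word_inv p @ p @ q @ word_inv q) (word_inv q @ word_inv p @ p)"
proof -
  have "vagner X (word_inv q @ (word_inv p @ word_inv (word_inv p) @ q @ word_inv q) @ [])
      (word_inv q @ (q @ word_inv q @ word_inv p @ word_inv (word_inv p)) @ [])"
    using assms by (intro vagner.cong vagner.commute) auto
  also have "vagner X (word_inv q @ (q @ word_inv q @ word_inv p @ word_inv (word_inv p)) @ [])
     (word_inv q @ word_inv p @ p)"
    using vagner.cong[OF vagner.regular[of "word_inv q" X], of "[]" "word_inv p @ p"] assms by simp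
  finally show ?thesis by simp
qed

lemma vagner_absorb':
  assumes "p \<in> lists (tilde X)" "q \<in> lists (tilde X)"
  shows "vagner X (q @ word_inv q @ word_inv p @ p @ q) (word_inv p @ p @ q)"
  using vagner_word_inv[OF vagner_absorb[OF assms]] by simp

text \<open>Conjugating by \<open>p @ q\<close> moves the base point of the Munn tree to the far end of a branch,
  which saves \<open>2 * (length q - length p)\<close> letters.\<close>

lemma not_ConjGeo:
  assumes "p \<in> lists (tilde X)" "q \<in> lists (tilde X)" "c \<in> lists (tilde X)"
    and "length p < length q"
  shows "p @ q @ word_inv q @ c @ q @ word_inv q @ word_inv p \<notin> ConjGeo X"
proof
  let ?w = "p @ q @ word_inv q @ c @ q @ word_inv q @ word_inv p"
  let ?u = "word_inv q @ word_inv p @ p @ c @ word_inv p @ p @ q"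
  let ?g = "p @ q"
  assume w: "?w \<in> ConjGeo X"
  have u: "vagner X (word_inv ?g @ ?w @ ?g) ?u"
    using vagner_append[OF vagner_append[OF vagner_absorb[OF assms(1,2)] vagner.refl[OF assms(3)]]
        vagner_absorb'[OF assms(1,2)]] by simp
  have "vagner X (?g @ ?u @ word_inv ?g) (?g @ (word_inv ?g @ ?w @ ?g) @ word_inv ?g)"
    using assms by (intro vagner.cong vagner.sym[OF u]) auto
  \<comment> \<open>\<open>?w\<close> begins with \<open>?g\<close> and ends with
    \<open>word_inv ?g\<close>, so conjugating back and forth is absorbed by regularity at both
    ends.\<close>
  also have "vagner X \<dots> ?w"
    using vagner_append[OF vagner_append[OF vagner.regular[of ?g X]
          vagner.refl[of "word_inv q @ c @ q" X]] vagner.regular[of "word_inv ?g" X]] assms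
    by simp
  finally have "vagner X (?g @ ?u @ word_inv ?g) ?w" .
  moreover have "?g \<in> lists (tilde X)" "?u \<in> lists (tilde X)" using assms by auto
  ultimately have "length ?w \<le> length ?u"
    using w u unfolding ConjGeo_iff by blast
  then show False using assms(4) by (simp add: word_inv_def)
qed

section \<open>Walks in inverse graphs\<close>

text \<open>The list records the edges used, always in their own orientation, so that traversals in
  both directions can be counted together.\<close>

inductive run :: "('v \<times> 'a \<times> 'v) set \<Rightarrow> 'v \<Rightarrow> 'a letter list \<Rightarrow> ('v \<times> 'a \<times> 'v) list \<Rightarrow> 'v \<Rightarrow> bool"
  for E where
  run_Nil: "run E p [] [] p"
| run_Pos: "(p, x, r) \<in> E \<Longrightarrow> run E r u es q \<Longrightarrow> run E p (Pos x # u) ((p, x, r) # es) q"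
| run_Neg: "(r, x, p) \<in> E \<Longrightarrow> run E r u es q \<Longrightarrow> run E p (Neg x # u) ((r, x, p) # es) q"

definition walk :: "('v \<times> 'a \<times> 'v) set \<Rightarrow> 'v \<Rightarrow> 'a letter list \<Rightarrow> 'v \<Rightarrow> bool" where
  "walk E p u q \<longleftrightarrow> (\<exists>es. run E p u es q)"

text \<open>These are the folded graphs: every letter acts as a partial injection on the
  vertices.\<close>

definition inverse_graph :: "('v \<times> 'a \<times> 'v) set \<Rightarrow> bool" where
  "inverse_graph E \<longleftrightarrow> (\<forall>p x q q'. (p, x, q) \<in> E \<longrightarrow> (p, x, q') \<in> E \<longrightarrow> q = q') \<and>
     (\<forall>p p' x q. (p, x, q) \<in> E \<longrightarrow> (p', x, q) \<in> E \<longrightarrow> p = p')"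

inductive_cases run_NilE [elim!]: "run E p [] es q"
inductive_cases run_PosE [elim!]: "run E p (Pos x # u) es q"
inductive_cases run_NegE [elim!]: "run E p (Neg x # u) es q"

lemma inverse_graph_subset: "inverse_graph E \<Longrightarrow> F \<subseteq> E \<Longrightarrow> inverse_graph F"
  unfolding inverse_graph_def by blast

lemma run_mono: "run E p u es q \<Longrightarrow> set es \<subseteq> F \<Longrightarrow> run F p u es q"
  by (induction rule: run.induct) (auto intro: run.intros)

lemma run_edges: "run E p u es q \<Longrightarrow> set es \<subseteq> E"
  by (induction rule: run.induct) auto

lemma run_length: "run E p u es q \<Longrightarrow> length es = length u"
  by (induction rule: run.induct) auto

lemma run_append:
  assumes "run E p u es r" "run E r v fs q"
  shows "run E p (u @ v) (es @ fs) q"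
  using assms by (induction rule: run.induct) (auto intro: run.intros)

lemma run_appendD:
  "run E p (u @ v) es q \<Longrightarrow> \<exists>es1 es2 r. run E p u es1 r \<and> run E r v es2 q \<and> es = es1 @ es2"
proof (induction u arbitrary: p es)
  case (Cons a u)
  show ?case
  proof (cases a)
    case (Pos x)
    with Cons.prems obtain r fs where r: "(p, x, r) \<in> E" "run E r (u @ v) fs q" "es = (p, x, r) # fs"
      by auto
    from Cons.IH[OF r(2)] obtain es1 es2 r' where "run E r u es1 r'" "run E r' v es2 q" "fs = es1 @ es2"
      by blast
    then show ?thesis using run_Pos[OF r(1)] Pos r(3) by (metis append_Cons)
  next
    case (Neg x)
    with Cons.prems obtain r fs where r: "(r, x, p) \<in> E" "run E r (u @ v) fs q" "es = (r, x, p) # fs"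
      by auto
    from Cons.IH[OF r(2)] obtain es1 es2 r' where "run E r u es1 r'" "run E r' v es2 q" "fs = es1 @ es2"
      by blast
    then show ?thesis using run_Neg[OF r(1)] Neg r(3) by (metis append_Cons)
  qed
qed (auto intro: run_Nil)

lemma run_word_inv:
  "run E p u es q \<Longrightarrow> run E q (word_inv u) (rev es) p"
proof (induction rule: run.induct)
  case (run_Pos p x r u es q)
  then have "run E r [Neg x] [(p, x, r)] p" by (intro run.intros)
  with run_append[OF run_Pos.IH] show ?case by (simp add: word_inv_def)
next
  case (run_Neg r x p u es q)
  then have "run E r [Pos x] [(r, x, p)] p" by (intro run.intros)
  with run_append[OF run_Neg.IH] show ?case by (simp add: word_inv_def)
qed (auto simp: word_inv_def intro: run_Nil)

lemma run_deterministic: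
  assumes "inverse_graph E" "run E p u es q" "run E p u es' q'"
  shows "es' = es \<and> q' = q"
  using assms(2,3)
proof (induction arbitrary: es' rule: run.induct)
  case (run_Pos p x r u es q)
  from run_Pos.prems run_Pos.hyps(1) obtain fs where "run E r u fs q'" "es' = (p, x, r) # fs"
    using assms(1) unfolding inverse_graph_def by blast
  then show ?case using run_Pos.IH by blast
next
  case (run_Neg r x p u es q)
  from run_Neg.prems run_Neg.hyps(1) obtain fs where "run E r u fs q'" "es' = (r, x, p) # fs"
    using assms(1) unfolding inverse_graph_def by blast
  then show ?case using run_Neg.IH by blast
qed auto

lemma walk_append: "walk E p (u @ v) q \<longleftrightarrow> (\<exists>r. walk E p u r \<and> walk E r v q)"
  unfolding walk_def using run_append run_appendD by metis

lemma walk_word_inv: "walk E p (word_inv u) q \<longleftrightarrow> walk E q u p"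
  unfolding walk_def using run_word_inv word_inv_inv by metis

lemma walk_deterministic:
  "inverse_graph E \<Longrightarrow> walk E p u q \<Longrightarrow> walk E p u q' \<Longrightarrow> q' = q"
  unfolding walk_def using run_deterministic by metis

lemma walk_deterministic':
  "inverse_graph E \<Longrightarrow> walk E p u q \<Longrightarrow> walk E p' u q \<Longrightarrow> p' = p"
  using walk_deterministic walk_word_inv by metis

text \<open>In an inverse graph words act as partial injections of the vertex set. These form an
  inverse monoid, so the defining relations hold for them.\<close>

lemma walk_vagner:
  assumes "vagner X u v" "inverse_graph E"
  shows "walk E p u q \<longleftrightarrow> walk E p v q"
  using assms(1)
proof (induction arbitrary: p q)
  case (regular u)
  show ?case unfolding walk_append walk_word_inv
    using walk_deterministic[OF assms(2)] walk_deterministic'[OF assms(2)] by metis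
next
  case (commute u v)
  show ?case unfolding walk_append walk_word_inv
    using walk_deterministic'[OF assms(2)] by metis
qed (auto simp: walk_append)

section \<open>Traversals of an edge that separates the graph\<close>

lemma run_crossing_parity:
  assumes "run E p u es q"
    and "\<And>a x b. (a, x, b) \<in> E \<Longrightarrow> (a \<in> S) \<noteq> (b \<in> S) \<longleftrightarrow> (a, x, b) = e"
  shows "even (count_list es e) \<longleftrightarrow> ((p \<in> S) = (q \<in> S))"
  using assms(1)
proof (induction rule: run.induct)
  case (run_Pos p x r u es q)
  then show ?case using assms(2)[of p x r] by auto
next
  case (run_Neg r x p u es q)
  then show ?case using assms(2)[of r x p] by auto
qed auto

text \<open>\<open>e\<close> is the only edge between \<open>S\<close> and its complement, so each
  traversal changes sides; a run ending on its starting side uses \<open>e\<close> an even number of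
  times.\<close>

lemma run_crossings:
  assumes "run E p u es q" "e \<in> set es"
    and "\<And>a x b. (a, x, b) \<in> E \<Longrightarrow> (a \<in> S) \<noteq> (b \<in> S) \<longleftrightarrow> (a, x, b) = e"
  shows "(if (p \<in> S) = (q \<in> S) then 2 else 1) \<le> int (count_list es e)"
proof -
  have "count_list es e \<noteq> 0" using assms(2) by (simp add: count_list_0_iff)
  moreover have "count_list es e \<noteq> 1" if "(p \<in> S) = (q \<in> S)"
    using run_crossing_parity[OF assms(1,3)] that by (metis odd_one)
  ultimately show ?thesis by auto
qed

text \<open>The conjugate walk stays inside the subgraph of its own edges \<open>set fs\<close>; reading
  \<open>word_inv g @ w @ g\<close> inside this subgraph shows that \<open>w\<close> can be read there as well, so it is everything.\<close>

lemma conjugate_run: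
  assumes E: "inverse_graph E"
    and w: "run E s w es t" "E \<subseteq> set es"
    and u: "vagner X (word_inv g @ w @ g) u" and w': "vagner X (g @ u @ word_inv g) w"
  shows "\<exists>s' t' fs. walk E s g s' \<and> walk E t g t' \<and> run E s' u fs t' \<and> set fs = E"
proof -
  have "walk E s w t" using w(1) unfolding walk_def by blast
  then have "walk E s (g @ u @ word_inv g) t" using walk_vagner[OF w' E] by simp
  then obtain s' t' where st: "walk E s g s'" "walk E s' u t'" "walk E t g t'"
    unfolding walk_append walk_word_inv by blast
  then obtain fs where fs: "run E s' u fs t'" unfolding walk_def by blast
  have fsE: "set fs \<subseteq> E" using run_edges[OF fs] .
  have "walk (set fs) s' u t'" using run_mono[OF fs subset_refl] unfolding walk_def by blast
  then have "walk (set fs) s' (word_inv g @ w @ g) t'"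
    using walk_vagner[OF u inverse_graph_subset[OF E fsE]] by simp
  then obtain r r' where r: "walk (set fs) r g s'" "walk (set fs) r w r'"
    unfolding walk_append walk_word_inv by blast
  have mono: "run E a v es' b" if "run (set fs) a v es' b" for a v es' b
    using run_mono[OF that] run_edges[OF that] fsE by blast
  \<comment> \<open>Both \<open>r\<close> and \<open>s\<close> lead to \<open>s'\<close> along
    \<open>g\<close>; backward determinism identifies them.\<close>
  have "walk E r g s'" using r(1) mono unfolding walk_def by blast
  then have "r = s" using walk_deterministic'[OF E st(1)] by simp
  then obtain es' where es': "run (set fs) s w es' r'" using r(2) unfolding walk_def by blast
  have "es' = es" using run_deterministic[OF E w(1) mono[OF es']] by simp
  then have "E \<subseteq> set fs" using run_edges[OF es'] w(2) by auto
  with st fs fsE show ?thesis by blast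
qed

section \<open>The words \<open>y\<^sup>i y\<^sup>-\<^sup>n x y\<^sup>m y\<^sup>-\<^sup>l\<close>\<close>

definition hword :: "'a \<Rightarrow> 'a \<Rightarrow> nat \<Rightarrow> nat \<Rightarrow> nat \<Rightarrow> nat \<Rightarrow> 'a letter list" where
  "hword y x i n m l =
     replicate i (Pos y) @ replicate n (Neg y) @ [Pos x] @ replicate m (Pos y) @ replicate l (Neg y)"

text \<open>The Munn tree of \<open>hword y x i n m l\<close> for \<open>k = i - n\<close> and \<open>k' = l - m\<close>: two vertical
  segments, the left one from \<open>0\<close> to \<open>i\<close> and the right one from \<open>-k'\<close> to \<open>m\<close>, joined by one
  edge from height \<open>k\<close> to height \<open>0\<close>.\<close>

definition hgraph :: "'a \<Rightarrow> 'a \<Rightarrow> int \<Rightarrow> int \<Rightarrow> int \<Rightarrow> int \<Rightarrow> ((bool \<times> int) \<times> 'a \<times> (bool \<times> int)) set" where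
  "hgraph y x i k m k' = (\<lambda>j. ((True, j), y, (True, j + 1))) ` {0..<i} \<union>
     (\<lambda>j. ((False, j), y, (False, j + 1))) ` {-k'..<m} \<union> {((True, k), x, (False, 0))}"

lemma inverse_graph_hgraph: "x \<noteq> y \<Longrightarrow> inverse_graph (hgraph y x i k m k')"
  unfolding inverse_graph_def hgraph_def by auto

lemma run_segment:
  assumes "\<And>j. t \<le> j \<Longrightarrow> j < t + int n \<Longrightarrow> ((b, j), y, (b, j + 1)) \<in> E"
  shows "\<exists>es. run E (b, t) (replicate n (Pos y)) es (b, t + int n) \<and>
    (\<lambda>j. ((b, j), y, (b, j + 1))) ` {t..<t + int n} \<subseteq> set es"
  using assms
proof (induction n arbitrary: t)
  case 0
  then show ?case by (auto intro: run_Nil)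
next
  case (Suc n)
  have "\<exists>es. run E (b, t + 1) (replicate n (Pos y)) es (b, t + 1 + int n) \<and>
    (\<lambda>j. ((b, j), y, (b, j + 1))) ` {t + 1..<t + 1 + int n} \<subseteq> set es"
    by (rule Suc.IH) (use Suc.prems in auto)
  then obtain es where es: "run E (b, t + 1) (replicate n (Pos y)) es (b, t + 1 + int n)"
    "(\<lambda>j. ((b, j), y, (b, j + 1))) ` {t + 1..<t + 1 + int n} \<subseteq> set es" by blast
  have "((b, t), y, (b, t + 1)) \<in> E" using Suc.prems by simp
  from run_Pos[OF this es(1)]
  have "run E (b, t) (replicate (Suc n) (Pos y)) (((b, t), y, (b, t + 1)) # es) (b, t + int (Suc n))"
    by (simp add: algebra_simps)
  moreover have "{t..<t + int (Suc n)} = insert t {t + 1..<t + 1 + int n}" by auto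
  then have "(\<lambda>j. ((b, j), y, (b, j + 1))) ` {t..<t + int (Suc n)} \<subseteq> set (((b, t), y, (b, t + 1)) # es)"
    using es(2) by auto
  ultimately show ?case by blast
qed

lemma word_inv_replicate: "word_inv (replicate n (Pos y)) = replicate n (Neg y)"
  by (simp add: word_inv_def)

lemma run_segment_back:
  assumes "\<And>j. t \<le> j \<Longrightarrow> j < t + int n \<Longrightarrow> ((b, j), y, (b, j + 1)) \<in> E"
  shows "\<exists>es. run E (b, t + int n) (replicate n (Neg y)) es (b, t) \<and>
    (\<lambda>j. ((b, j), y, (b, j + 1))) ` {t..<t + int n} \<subseteq> set es"
proof -
  obtain es where "run E (b, t) (replicate n (Pos y)) es (b, t + int n)"
    "(\<lambda>j. ((b, j), y, (b, j + 1))) ` {t..<t + int n} \<subseteq> set es"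
    using run_segment[of t n b y E] assms by blast
  with run_word_inv[of E "(b, t)" "replicate n (Pos y)" es] show ?thesis
    by (intro exI[of _ "rev es"]) (simp add: word_inv_replicate)
qed

text \<open>The first and last blocks run along the whole left and right segments and
  \<open>x\<close> crosses the joining edge, so the tree is covered. The hypotheses keep the inner
  blocks inside the segments.\<close>

lemma run_hword:
  fixes x y :: 'a and i n m l :: nat
  assumes "n \<le> i" "m \<le> l"
  defines "k \<equiv> int i - int n" and "k' \<equiv> int l - int m"
  defines "E \<equiv> hgraph y x (int i) k (int m) k'"
  shows "\<exists>es. run E (True, 0) (hword y x i n m l) es (False, - k') \<and> E \<subseteq> set es"
proof -
  let ?f = "\<lambda>b j. ((b, j), y, (b, j + (1::int)))"
  have L: "?f True j \<in> E" if "0 \<le> j" "j < int i" for j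
    using that unfolding E_def hgraph_def by auto
  have R: "?f False j \<in> E" if "- k' \<le> j" "j < int m" for j
    using that unfolding E_def hgraph_def by auto
  have X: "((True, k), x, (False, 0)) \<in> E" unfolding E_def hgraph_def by simp
  obtain e1 where e1: "run E (True, 0) (replicate i (Pos y)) e1 (True, int i)" "?f True ` {0..<int i} \<subseteq> set e1"
    using run_segment[of 0 i True y E] L by auto
  obtain e2 where e2: "run E (True, int i) (replicate n (Neg y)) e2 (True, k)"
    using run_segment_back[of k n True y E] L assms(1) unfolding k_def by auto
  have e3: "run E (True, k) [Pos x] [((True, k), x, (False, 0))] (False, 0)"
    using X by (intro run.intros)
  obtain e4 where e4: "run E (False, 0) (replicate m (Pos y)) e4 (False, int m)"
    using run_segment[of 0 m False y E] R assms(2) unfolding k'_def by auto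
  obtain e5 where e5: "run E (False, int m) (replicate l (Neg y)) e5 (False, - k')"
    "?f False ` {- k'..<int m} \<subseteq> set e5"
    using run_segment_back[of "- k'" l False y E] R unfolding k'_def by auto
  have "run E (True, 0) (hword y x i n m l)
      (e1 @ e2 @ [((True, k), x, (False, 0))] @ e4 @ e5) (False, - k')"
    unfolding hword_def by (intro run_append[OF e1(1)] run_append[OF e2(1)] run_append[OF e3] run_append[OF e4(1)] e5(1))
  moreover have "E \<subseteq> set (e1 @ e2 @ [((True, k), x, (False, 0))] @ e4 @ e5)"
    using e1(2) e5(2) unfolding E_def hgraph_def by auto
  ultimately show ?thesis by blast
qed

text \<open>Two points on different sides cannot cross the joining edge simultaneously, so they can only
  move up and down together.\<close>

lemma hgraph_parallel_walks:
  assumes "x \<noteq> y"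
    and "run (hgraph y x i k m k') (True, a) g es s'" "run (hgraph y x i k m k') (False, a - k') g fs t'"
    and "0 \<le> a" "a \<le> i" "a \<le> m + k'"
  shows "\<exists>j. s' = (True, j) \<and> t' = (False, j - k') \<and> 0 \<le> j \<and> j \<le> i \<and> j \<le> m + k'"
  using assms(2-)
proof (induction g arbitrary: a es fs)
  case (Cons c g)
  have "\<exists>a' es' fs'. run (hgraph y x i k m k') (True, a') g es' s' \<and>
    run (hgraph y x i k m k') (False, a' - k') g fs' t' \<and> 0 \<le> a' \<and> a' \<le> i \<and> a' \<le> m + k'"
  proof (cases c)
    \<comment> \<open>\<open>Pos x\<close> cannot be read at the right point, and
      \<open>Neg x\<close> cannot be read at the left one, so \<open>z = y\<close> in both
      cases.\<close>
    case (Pos z)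
    then have "run (hgraph y x i k m k') (True, a + 1) g (tl es) s'"
      "run (hgraph y x i k m k') (False, a + 1 - k') g (tl fs) t'" "a < i" "a - k' < m"
      using Cons.prems(1,2) assms(1) by (auto simp: hgraph_def algebra_simps)
    then show ?thesis using Cons.prems by (intro exI[of _ "a + 1"] exI conjI) auto
  next
    case (Neg z)
    then have "run (hgraph y x i k m k') (True, a - 1) g (tl es) s'"
      "run (hgraph y x i k m k') (False, a - 1 - k') g (tl fs) t'" "0 < a"
      using Cons.prems(1,2) assms(1) by (auto simp: hgraph_def algebra_simps)
    then show ?thesis using Cons.prems by (intro exI[of _ "a - 1"] exI conjI) auto
  qed
  then show ?case using Cons.IH by blast
qed auto

section \<open>Lower bounds for covering walks\<close>

lemma sum_crossings:
  fixes a b lo hi :: int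
  assumes "lo \<le> a" "a \<le> hi" "lo \<le> b" "b \<le> hi"
  shows "(\<Sum>j\<in>{lo..<hi}. if (a > j) = (b > j) then 2 else 1 :: int) = 2 * (hi - lo) - \<bar>a - b\<bar>"
proof -
  \<comment> \<open>The edge from \<open>j\<close> to \<open>j + 1\<close> separates
    \<open>a\<close> and \<open>b\<close> exactly for \<open>min a b <= j < max a b\<close>.\<close>
  have "(\<Sum>j\<in>{lo..<hi}. if (a > j) = (b > j) then 2 else 1 :: int) =
      (\<Sum>j\<in>{lo..<hi}. 2 - (if j \<in> {min a b..<max a b} then 1 else 0))"
    by (rule sum.cong) auto
  also have "\<dots> = 2 * (hi - lo) - (\<Sum>j\<in>{lo..<hi}. if j \<in> {min a b..<max a b} then 1 else 0)"
    using assms unfolding sum_subtractf by simp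
  also have "(\<Sum>j\<in>{lo..<hi}. if j \<in> {min a b..<max a b} then 1 else 0) =
      (\<Sum>j\<in>{lo..<hi} \<inter> {min a b..<max a b}. 1 :: int)"
    by (rule sum.inter_restrict[symmetric]) simp
  also have "{lo..<hi} \<inter> {min a b..<max a b} = {min a b..<max a b}" using assms by auto
  also have "(\<Sum>j\<in>{min a b..<max a b}. 1 :: int) = \<bar>a - b\<bar>" by (simp add: min_def max_def)
  finally show ?thesis .
qed

text \<open>Every edge of the tree is a bridge, used at least once if it lies between the end points
  and at least twice otherwise. The path between them leaves the left segment at height
  \<open>k\<close> and enters the right one at height 0.\<close>

lemma hgraph_covering_run_length:
  assumes "x \<noteq> y" "run E (True, a) u es (False, c)" "set es = E" "E = hgraph y x i k m k'"
    and "0 \<le> a" "a \<le> i" "0 \<le> k" "k \<le> i" "- k' \<le> c" "c \<le> m" "0 \<le> k'" "0 \<le> m"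
  shows "2 * (i + m + k') + 1 - \<bar>a - k\<bar> - \<bar>c\<bar> \<le> int (length u)"
proof -
  let ?f = "\<lambda>b j. ((b, j), y, (b, j + (1::int)))"
  let ?x = "((True, k), x, (False, 0::int))"
  let ?A = "?f True ` {0..<i}" and ?B = "?f False ` {- k'..<m}"
  have E: "E = ?A \<union> ?B \<union> {?x}" using assms(4) unfolding hgraph_def .
  have fin: "finite ?A" "finite ?B" by auto
  have "length es = (\<Sum>e\<in>E. count_list es e)"
    by (rule sum_count_set[symmetric]) (use assms(3) E in auto)
  also have "\<dots> = sum (count_list es) ?A + sum (count_list es) ?B + count_list es ?x"
    unfolding E using assms(1) by (subst sum.union_disjoint; auto)+
  also have "sum (count_list es) ?A = (\<Sum>j\<in>{0..<i}. count_list es (?f True j))"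
    by (subst sum.reindex) (auto simp: inj_on_def)
  also have "sum (count_list es) ?B = (\<Sum>j\<in>{- k'..<m}. count_list es (?f False j))"
    by (subst sum.reindex) (auto simp: inj_on_def)
  finally have len: "int (length u) = (\<Sum>j\<in>{0..<i}. int (count_list es (?f True j))) +
     (\<Sum>j\<in>{- k'..<m}. int (count_list es (?f False j))) + int (count_list es ?x)"
    using run_length[OF assms(2)] by simp
  have left: "(if (a > j) = (k > j) then 2 else 1) \<le> int (count_list es (?f True j))" if j: "j \<in> {0..<i}" for j
  proof -
    \<comment> \<open>One side of the removed edge: the left vertices above it, with the whole right
      segment if that is attached above it.\<close>
    let ?S = "{(b, h). if b then h > j else k > j}"
    have "(if ((True, a) \<in> ?S) = ((False, c) \<in> ?S) then 2 else 1) \<le> int (count_list es (?f True j))"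
      by (rule run_crossings[OF assms(2)]) (use j assms(1,3) E in auto)
    then show ?thesis by simp
  qed
  have "2 * i - \<bar>a - k\<bar> = (\<Sum>j\<in>{0..<i}. if (a > j) = (k > j) then 2 else 1)"
    using sum_crossings[of 0 a i k] assms by simp
  also have "\<dots> \<le> (\<Sum>j\<in>{0..<i}. int (count_list es (?f True j)))"
    by (rule sum_mono) (rule left)
  finally have A: "2 * i - \<bar>a - k\<bar> \<le> (\<Sum>j\<in>{0..<i}. int (count_list es (?f True j)))" .
  have right: "(if (c > j) = (0 > j) then 2 else 1) \<le> int (count_list es (?f False j))"
    if j: "j \<in> {- k'..<m}" for j
  proof -
    \<comment> \<open>Here the left segment hangs at height 0 of the right one.\<close>
    let ?S = "{(b, h). if b then 0 > j else h > j}"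
    have "(if ((True, a) \<in> ?S) = ((False, c) \<in> ?S) then 2 else 1) \<le> int (count_list es (?f False j))"
      by (rule run_crossings[OF assms(2)]) (use j assms(1,3) E in auto)
    then show ?thesis by (simp add: eq_commute)
  qed
  have "2 * (m + k') - \<bar>c\<bar> = (\<Sum>j\<in>{- k'..<m}. if (c > j) = (0 > j) then 2 else 1)"
    using sum_crossings[of "- k'" c m 0] assms by simp
  also have "\<dots> \<le> (\<Sum>j\<in>{- k'..<m}. int (count_list es (?f False j)))"
    by (rule sum_mono) (rule right)
  finally have B: "2 * (m + k') - \<bar>c\<bar> \<le> (\<Sum>j\<in>{- k'..<m}. int (count_list es (?f False j)))" .
  have "1 \<le> int (count_list es ?x)"
  proof -
    have "?x \<in> set es" using assms(3) E by simp
    then have "count_list es ?x \<noteq> 0" by (simp add: count_list_0_iff)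
    then show ?thesis by simp
  qed
  from add_mono[OF add_mono[OF A B] this] show ?thesis
    unfolding len by (simp add: algebra_simps)
qed

section \<open>Which of these words are conjugacy geodesics\<close>

lemma hword_ConjGeo:
  assumes "x \<in> X" "y \<in> X" "x \<noteq> y" "n \<le> i" "m \<le> l" "n + m \<le> i \<or> n + m \<le> l"
  shows "hword y x i n m l \<in> ConjGeo X"
proof -
  define k k' where "k = int i - int n" and "k' = int l - int m"
  define E where "E = hgraph y x (int i) k (int m) k'"
  have E: "inverse_graph E" unfolding E_def by (rule inverse_graph_hgraph[OF assms(3)])
  obtain es where es: "run E (True, 0) (hword y x i n m l) es (False, - k')" "E \<subseteq> set es"
    using run_hword[OF assms(4,5), of y x] unfolding E_def k_def k'_def by blast
  have "length (hword y x i n m l) \<le> length u"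
    if u: "vagner X (word_inv g @ hword y x i n m l @ g) u" "vagner X (g @ u @ word_inv g) (hword y x i n m l)" for u g
  proof -
    obtain s' t' fs where st: "walk E (True, 0) g s'" "walk E (False, - k') g t'"
      and fs: "run E s' u fs t'" "set fs = E"
      using conjugate_run[OF E es u] by blast
    obtain es1 es2 where es12: "run E (True, 0) g es1 s'" "run E (False, 0 - k') g es2 t'"
      using st unfolding walk_def by auto
    have "\<exists>j. s' = (True, j) \<and> t' = (False, j - k') \<and> 0 \<le> j \<and> j \<le> int i \<and> j \<le> int m + k'"
      by (rule hgraph_parallel_walks[OF assms(3) es12[unfolded E_def]]) (use assms k'_def in auto)
    then obtain j where j: "s' = (True, j)" "t' = (False, j - k')" "0 \<le> j" "j \<le> int i" "j \<le> int m + k'"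
      by blast
    have A: "2 * (int i + int m + k') + 1 - \<bar>j - k\<bar> - \<bar>j - k'\<bar> \<le> int (length u)"
      by (rule hgraph_covering_run_length[OF assms(3) fs(1)[unfolded j(1,2)] fs(2) E_def])
        (use j assms k_def k'_def in auto)
    \<comment> \<open>By convexity in \<open>j\<close> only the extreme values matter: equality
      holds at 0, and at \<open>min i l\<close> the bound comes from
      \<open>n + m <= max i l\<close>.\<close>
    have B: "\<bar>j - k\<bar> + \<bar>j - k'\<bar> \<le> k + k'"
      using assms(6) j(3-5) assms(4,5) unfolding k_def k'_def by (elim disjE) linarith+
    have "c + 1 - (k + k') \<le> d" if "c + 1 - a - b \<le> d" "a + b \<le> k + k'" for a b c d :: int
      using that by linarith
    \<comment> \<open>The resulting lower bound is \<open>i + n + 1 + m + l\<close>, the length of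
      the word itself.\<close>
    from this[OF A B] show ?thesis unfolding k_def k'_def by (simp add: hword_def)
  qed
  moreover have "hword y x i n m l \<in> lists (tilde X)"
    using assms(1,2) by (auto simp: hword_def tilde_def)
  ultimately show ?thesis unfolding ConjGeo_iff by blast
qed

text \<open>The symmetric word has the shape of \<open>not_ConjGeo\<close> with \<open>p\<close> and
  \<open>q\<close> powers of \<open>y\<close>, of exponents \<open>i - n\<close> and
  \<open>n\<close>; \<open>i < n + n\<close> says that \<open>p\<close> is the shorter one.\<close>

lemma hword_not_ConjGeo:
  assumes "x \<in> X" "y \<in> X" "i < n + n" "n \<le> i"
  shows "hword y x i n n i \<notin> ConjGeo X"
proof -
  let ?p = "replicate (i - n) (Pos y)" and ?q = "replicate n (Pos y)"
  have "replicate i c = replicate (i - n) c @ replicate n c" "replicate i c = replicate n c @ replicate (i - n) c"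
    for c :: "'a letter" using assms(4) by (simp_all flip: replicate_add)
  then have "hword y x i n n i = ?p @ ?q @ word_inv ?q @ [Pos x] @ ?q @ word_inv ?q @ word_inv ?p"
    unfolding hword_def word_inv_replicate by simp
  moreover have "?p @ ?q @ word_inv ?q @ [Pos x] @ ?q @ word_inv ?q @ word_inv ?p \<notin> ConjGeo X"
    by (rule not_ConjGeo) (use assms in \<open>auto simp: tilde_def\<close>)
  ultimately show ?thesis by simp
qed

section \<open>Pumped words of the form \<open>y\<^sup>i y\<^sup>-\<^sup>n x y\<^sup>m y\<^sup>-\<^sup>l\<close>\<close>

text \<open>The five blocks of \<open>hword\<close> are numbered, so that the word becomes the image of a sorted
  list and pumping can be controlled by counting.\<close>

definition hletter :: "'a \<Rightarrow> 'a \<Rightarrow> nat \<Rightarrow> 'a letter" where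
  "hletter y x j = (if j = 2 then Pos x else if j = 0 \<or> j = 3 then Pos y else Neg y)"

definition blocks :: "(nat \<Rightarrow> nat) \<Rightarrow> nat list" where
  "blocks d = concat (map (\<lambda>j. replicate (d j) j) [0, 1, 2, 3, 4])"

lemma map_hletter_blocks:
  "d 2 = 1 \<Longrightarrow> map (hletter y x) (blocks d) = hword y x (d 0) (d 1) (d 3) (d 4)"
  by (simp add: blocks_def hword_def hletter_def)

lemma sorted_blocks: "sorted (blocks d)"
  by (auto simp: blocks_def sorted_append)

lemma set_blocks: "set (blocks d) \<subseteq> {..4}"
  by (auto simp: blocks_def)

lemma count_blocks: "j \<le> 4 \<Longrightarrow> count_list (blocks d) j = d j"
proof -
  have replicate: "count_list (replicate a b) j = (if b = j then a else 0)" for a b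
    by (induction a) auto
  assume "j \<le> 4"
  then have "j \<in> {0, 1, 2, 3, 4}" by auto
  then show ?thesis by (auto simp: blocks_def replicate)
qed

text \<open>A sorted list is determined by its multiset, so a pumped word can be identified by
  counting alone.\<close>

lemma sorted_eq_blocks:
  assumes "sorted w" "set w \<subseteq> {..4}"
  shows "w = blocks (count_list w)"
proof -
  have "mset w = mset (blocks (count_list w))"
  proof (rule multiset_eqI)
    fix j
    show "count (mset w) j = count (mset (blocks (count_list w))) j"
    proof (cases "j \<le> 4")
      case False
      then have "j \<notin> set w" "j \<notin> set (blocks (count_list w))"
        using assms(2) set_blocks[of "count_list w"] by auto
      then show ?thesis by (metis count_list_0_iff count_mset)
    qed (simp add: count_mset count_blocks)
  qed
  then show ?thesis
    using properties_for_sort[OF _ assms(1)] properties_for_sort[OF _ sorted_blocks] by metis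
qed

text \<open>Sortedness places every occurrence of \<open>c\<close> between those of \<open>a\<close>
  and \<open>b\<close>, hence inside \<open>s\<close>.\<close>

lemma sorted_factor_count:
  assumes "sorted (u @ s @ z)" "a \<in> set s" "b \<in> set s" "a < c" "c < b"
  shows "count_list (u @ s @ z) c \<le> length s"
proof -
  have "c \<notin> set u" "c \<notin> set z" using assms by (force simp: sorted_append)+
  then show ?thesis using count_le_length[of s c] by simp
qed

text \<open>\<open>v\<close> precedes \<open>x\<close> and its letters recur in \<open>x\<close>, so
  they all coincide; likewise for \<open>y\<close>. Repeating constant words preserves
  sortedness.\<close>

lemma sorted_pump:
  assumes "sorted (u @ v @ x @ y @ z)" "set v \<subseteq> set x" "set y \<subseteq> set x"
  shows "sorted (u @ concat (replicate t v) @ x @ concat (replicate t y) @ z)"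
proof -
  have *: "sorted (concat (replicate t s))" if "\<And>a b. a \<in> set s \<Longrightarrow> b \<in> set s \<Longrightarrow> a \<le> b" for s :: "'a list"
  proof -
    have "sorted s" using that by (simp add: sorted_wrt_iff_nth_less sorted_iff_nth_mono)
    then show ?thesis using that by (induction t) (auto simp: sorted_append)
  qed
  have "sorted (concat (replicate t v))" "sorted (concat (replicate t y))"
    using assms by (intro *; force simp: sorted_append)+
  then show ?thesis using assms(1) by (auto simp: sorted_append)
qed

lemma count_list_concat_replicate: "count_list (concat (replicate t v)) a = t * count_list v a"
  by (induction t) auto

lemma map_concat_replicate: "map h (concat (replicate t v)) = concat (replicate t (map h v))"
  by (simp add: map_concat)

text \<open>The factor is too short to reach across the second or fourth block. Together with
  \<open>same\<close> this makes \<open>v\<close> and \<open>r\<close> powers of single block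
  letters, so the exponents are linear in \<open>t\<close>.\<close>

lemma hword_pump:
  assumes "x \<noteq> y" and w: "hword y x i n m l = u @ v @ c @ r @ z"
    and p: "length (v @ c @ r) < n" "length (v @ c @ r) < m"
    and same: "set (v @ c @ r) = set c"
  shows "\<exists>i' n' m' l' di dn dm dl. i = i' + di \<and> n = n' + dn \<and> m = m' + dm \<and> l = l' + dl \<and>
    (di = 0 \<or> dl = 0) \<and> di + dn + dm + dl = length (v @ r) \<and>
    (\<forall>t. u @ concat (replicate t v) @ c @ concat (replicate t r) @ z =
       hword y x (i' + t * di) (n' + t * dn) (m' + t * dm) (l' + t * dl))"
proof -
  let ?h = "hletter y x"
  define d where "d j = (if j = 0 then i else if j = 1 then n else if j = 2 then 1 else if j = 3 then m else l)"
    for j :: nat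
  have d: "d 0 = i" "d 1 = n" "d 2 = 1" "d 3 = m" "d 4 = l" by (simp_all add: d_def)
  have "map ?h (blocks d) = u @ v @ c @ r @ z"
    using map_hletter_blocks[of d y x] d w by simp
  \<comment> \<open>The factorization is lifted to block numbers, which tell apart the two blocks of
    \<open>Pos y\<close> and the two of \<open>Neg y\<close>.\<close>
  then obtain U T1 where "blocks d = U @ T1" "u = map ?h U" "v @ c @ r @ z = map ?h T1"
    unfolding map_eq_append_conv by blast
  moreover from this(3)[symmetric] obtain V T2 where "T1 = V @ T2" "v = map ?h V" "c @ r @ z = map ?h T2"
    unfolding map_eq_append_conv by blast
  moreover from this(3)[symmetric] obtain C T3 where "T2 = C @ T3" "c = map ?h C" "r @ z = map ?h T3"
    unfolding map_eq_append_conv by blast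
  moreover from this(3)[symmetric] obtain R Z where "T3 = R @ Z" "r = map ?h R" "z = map ?h Z"
    unfolding map_eq_append_conv by blast
  ultimately have W: "blocks d = U @ V @ C @ R @ Z"
    and uvcrz: "u = map ?h U" "v = map ?h V" "c = map ?h C" "r = map ?h R" "z = map ?h Z"
    by simp_all
  let ?F = "V @ C @ R"
  have sorted: "sorted (U @ V @ C @ R @ Z)" using sorted_blocks[of d] W by simp
  have le4: "set (U @ V @ C @ R @ Z) \<subseteq> {..4}" using set_blocks[of d] W by simp
  have short: False if "a \<in> set ?F" "b \<in> set ?F" "a < j" "j < b" "j = 1 \<or> j = 3" for a b j
  proof -
    have "count_list (blocks d) j \<le> length ?F"
      using sorted_factor_count[of U ?F Z, OF _ that(1-4)] sorted W by simp
    then have "d j \<le> length ?F" using that(5) count_blocks[of j d] by auto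
    then show False using that(5) p uvcrz d by auto
  qed
  have far: "\<not> (0 \<in> set ?F \<and> 3 \<in> set ?F)" "\<not> (1 \<in> set ?F \<and> 4 \<in> set ?F)" "\<not> (0 \<in> set ?F \<and> 4 \<in> set ?F)"
    using short[of 0 3 1] short[of 1 4 3] short[of 0 4 1] by auto
  \<comment> \<open>\<open>?h\<close> only identifies 0 with 3 and 1 with 4; by \<open>far\<close>
    it is injective on the factor, so equality of letters lifts to block numbers.\<close>
  have sub: "set ?F \<subseteq> set C"
  proof
    fix a assume a: "a \<in> set ?F"
    then have "?h a \<in> set c" using same uvcrz by auto
    then obtain b where b: "b \<in> set C" "?h b = ?h a" using uvcrz by auto
    have "b \<in> set ?F" using b by simp
    then have "a \<le> 4" "b \<le> 4" using a le4 by auto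
    then have "a \<in> {0, 1, 2, 3, 4}" "b \<in> {0, 1, 2, 3, 4}" by auto
    then have "a = b" using b(2) assms(1) far a \<open>b \<in> set ?F\<close>
      by (auto simp: hletter_def simp del: set_append split: if_splits)
    then show "a \<in> set C" using b by simp
  qed
  define D where "D j = count_list (V @ R) j" for j
  define B where "B j = count_list (U @ C @ Z) j" for j
  have dBD: "d j = B j + D j" if "j \<le> 4" for j
    using count_blocks[OF that, of d] unfolding W B_def D_def by simp
  \<comment> \<open>An \<open>x\<close> in \<open>v\<close> or \<open>r\<close> would recur in
    \<open>c\<close>, but the word contains only one \<open>x\<close>.\<close>
  have D2: "D 2 = 0"
  proof (rule ccontr)
    assume "D 2 \<noteq> 0"
    then have "2 \<in> set ?F" unfolding D_def by (auto simp: count_list_0_iff)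
    then have "count_list C 2 \<noteq> 0" using sub by (auto simp: count_list_0_iff)
    then have "B 2 \<noteq> 0" unfolding B_def by simp
    then show False using \<open>D 2 \<noteq> 0\<close> dBD[of 2] d by simp
  qed
  have "D 0 = 0 \<or> D 4 = 0"
  proof (rule ccontr)
    assume "\<not> (D 0 = 0 \<or> D 4 = 0)"
    then have "0 \<in> set ?F" "4 \<in> set ?F" unfolding D_def by (auto simp: count_list_0_iff)
    then show False using far(3) by blast
  qed
  moreover have "D 0 + D 1 + D 3 + D 4 = length (v @ r)"
  proof -
    have "length (V @ R) = (\<Sum>j\<in>{..4}. D j)"
      unfolding D_def by (rule sum_count_set[symmetric]) (use le4 in auto)
    also have "{..4} = {0, 1, 2, 3, 4::nat}" by auto
    finally show ?thesis using uvcrz D2 by simp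
  qed
  moreover have "u @ concat (replicate t v) @ c @ concat (replicate t r) @ z =
       hword y x (B 0 + t * D 0) (B 1 + t * D 1) (B 3 + t * D 3) (B 4 + t * D 4)" for t
  proof -
    let ?W = "U @ concat (replicate t V) @ C @ concat (replicate t R) @ Z"
    have "sorted ?W" using sorted_pump[OF sorted] sub by simp
    moreover have "set ?W \<subseteq> {..4}" using le4 by auto
    ultimately have eq: "?W = blocks (count_list ?W)" by (rule sorted_eq_blocks)
    have count: "count_list ?W j = B j + t * D j" for j
      by (simp add: B_def D_def count_list_concat_replicate algebra_simps)
    have "u @ concat (replicate t v) @ c @ concat (replicate t r) @ z = map ?h ?W"
      by (simp add: uvcrz map_concat_replicate)
    also have "\<dots> = map ?h (blocks (count_list ?W))" by (subst eq) (rule HOL.refl)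
    also have "\<dots> = hword y x (B 0 + t * D 0) (B 1 + t * D 1) (B 3 + t * D 3) (B 4 + t * D 4)"
      using map_hletter_blocks[of "count_list ?W" y x] dBD[of 2] d D2 unfolding count by simp
    finally show ?thesis .
  qed
  moreover have "i = B 0 + D 0" "n = B 1 + D 1" "m = B 3 + D 3" "l = B 4 + D 4"
    using dBD[of 0] dBD[of 1] dBD[of 3] dBD[of 4] d by simp_all
  ultimately show ?thesis by blast
qed

section \<open>Pumping the words with \<open>n = m\<close> and
  \<open>i = l = 2 * n - 1\<close>\<close>

theorem theorem3p6:
  fixes X :: "'a set"
  assumes "finite X" and "card X \<ge> 2"
  shows "\<not> context_free (tilde X) (lists (tilde X) - ConjGeo X)"
proof
  assume cf: "context_free (tilde X) (lists (tilde X) - ConjGeo X)"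
  obtain x y where xy: "x \<in> X" "y \<in> X" "x \<noteq> y"
    using assms by (metis card_le_Suc0_iff_eq not_less_eq_eq numeral_2_eq_2)
  let ?A = "{Pos x, Pos y, Neg y}"
  \<comment> \<open>Recording which letters occur has finite range and supplies the condition that
    \<open>v\<close> and \<open>r\<close> only use letters of \<open>c\<close>.\<close>
  let ?f = "\<lambda>w :: 'a letter list. set w \<inter> ?A"
  have "finite (range ?f)" by (rule finite_subset[of _ "Pow ?A"]) auto
  from pumping[OF cf this] obtain p where p: "\<And>w. w \<in> lists (tilde X) - ConjGeo X \<Longrightarrow> p < length w \<Longrightarrow>
    \<exists>u v c r z. w = u @ v @ c @ r @ z \<and> v @ r \<noteq> [] \<and> length (v @ c @ r) \<le> p \<and>
      ?f (v @ c @ r) = ?f c \<and>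
      (\<forall>t. u @ concat (replicate t v) @ c @ concat (replicate t r) @ z \<in> lists (tilde X) - ConjGeo X)"
    by blast
  \<comment> \<open>\<open>n\<close> exceeds the pumping constant, so the factor is shorter than the
    inner blocks; \<open>i\<close> is the largest value below \<open>n + n\<close>.\<close>
  define n where "n = Suc p"
  define i where "i = n + p"
  let ?w = "hword y x i n n i"
  have "?w \<notin> ConjGeo X"
    using xy by (intro hword_not_ConjGeo) (auto simp: n_def i_def)
  moreover have "?w \<in> lists (tilde X)" using xy by (auto simp: hword_def tilde_def)
  ultimately have mem: "?w \<in> lists (tilde X) - ConjGeo X" by (rule DiffI[rotated])
  have "p < length ?w" by (simp add: hword_def n_def)
  from p[OF mem this] obtain u v c r z where w: "?w = u @ v @ c @ r @ z" and ne: "v @ r \<noteq> []"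
    and len: "length (v @ c @ r) \<le> p" and same: "?f (v @ c @ r) = ?f c"
    and "\<forall>t. u @ concat (replicate t v) @ c @ concat (replicate t r) @ z \<in> lists (tilde X) - ConjGeo X"
    by (elim exE conjE) (rule that)
  then have pump: "u @ concat (replicate t v) @ c @ concat (replicate t r) @ z \<notin> ConjGeo X" for t
    by blast
  have "set ?w \<subseteq> ?A" by (auto simp: hword_def)
  then have "set (v @ c @ r) \<subseteq> ?A" unfolding w by auto
  then have "set (v @ c @ r) = set c" using same by auto
  moreover have "length (v @ c @ r) < n" using len n_def by simp
  ultimately obtain i' n' m' l' di dn dm dl where
    eqs: "i = i' + di" "n = n' + dn" "n = m' + dm" "i = l' + dl" "di = 0 \<or> dl = 0"
      "di + dn + dm + dl = length (v @ r)" and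
    pumped: "\<And>t. u @ concat (replicate t v) @ c @ concat (replicate t r) @ z =
       hword y x (i' + t * di) (n' + t * dn) (m' + t * dm) (l' + t * dl)"
    using hword_pump[OF xy(3) w] by blast
  have pos: "0 < di + dn + dm + dl" "di + dn + dm + dl \<le> p" using ne len eqs(6) by auto
  have "hword y x (i' + t * di) (n' + t * dn) (m' + t * dm) (l' + t * dl) \<notin> ConjGeo X" for t
    using pump[of t] unfolding pumped .
  \<comment> \<open>One copy is removed for \<open>t = 0\<close> and one is added for
    \<open>t = 2\<close>.\<close>
  from this[of 0] this[of 2] have
    down: "\<not> (n' \<le> i' \<and> m' \<le> l' \<and> (n' + m' \<le> i' \<or> n' + m' \<le> l'))" and
    up: "\<not> (n + dn \<le> i + di \<and> n + dm \<le> i + dl \<and> (n + n + dn + dm \<le> i + di \<or> n + n + dn + dm \<le> i + dl))"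
    using hword_ConjGeo[OF xy] eqs(1-4) by (auto simp: algebra_simps)
  show False
  \<comment> \<open>With the inner blocks unchanged, pumping up raises \<open>i\<close> or
    \<open>l\<close> to at least \<open>n + n\<close>. Otherwise pumping down makes
    \<open>n' + m'\<close> at most \<open>i\<close>, one outer block keeps length \<open>i\<close>,
    and both keep at least \<open>i - p = n\<close>.\<close>
  proof (cases "dn + dm = 0")
    case True
    then show ?thesis using up pos eqs(5) unfolding i_def n_def by auto
  next
    case False
    then show ?thesis using down pos eqs(1-5) unfolding i_def n_def by auto
  qed
qed

end
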